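(* Let $V$ be an invertible operator on $\mathcal{H}^N$ and let $\{F_\varsigma\}_{\varsigma\in\mathfrak{A}}$ be a $V$-controlled integral frame for $\mathcal{H}^N$ whose controlled frame operator $S_{VF}$ is a normal operator with $VS_{VF}=S_{VF}V$. Then $V$ is a positive operator.
   Context: $(\mathfrak{A},\mu)$ is a measure space with positive measure $\mu$, and $\mathcal{H}^N$ is an $N$-dimensional complex Hilbert space, with inner product linear in the first variable. Families are assumed weakly measurable: $\varsigma\mapsto\langle f,F_\varsigma\rangle$ is measurable for each $f$. For an invertible operator $V$ on $\mathcal{H}^N$, a family $\{F_\varsigma\}_{\varsigma\in\mathfrak{A}}\subset\mathcal{H}^N$ is a $V$-controlled integral frame if there are $0<A\le B<\infty$ with $A\|f\|^2\le\int_{\mathfrak{A}}\langle f,F_\varsigma\rangle\langle VF_\varsigma,f\rangle\,d\mu(\varsigma)\le B\|f\|^2$ for all $f\in\mathcal{H}^N$ (in particular the integral exists and is real). Its controlled frame operator is $S_{VF}f=\int_{\mathfrak{A}}\langle f,F_\varsigma\rangle VF_\varsigma\,d\mu(\varsigma)$ (weak sense). *)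

theory Defs
  imports "HOL-Analysis.Analysis"
begin

text \<open>Complex inner product spaces, with the inner product linear in the first variable.  No
  completeness axiom is imposed: together with the finite dimension required below it is automatic.\<close>

class complex_inner = ab_group_add +
  fixes scaleC :: "complex \<Rightarrow> 'a \<Rightarrow> 'a"  (infixr "*\<^sub>C" 75)
    and cinner :: "'a \<Rightarrow> 'a \<Rightarrow> complex"
  assumes scaleC_add_right: "a *\<^sub>C (x + y) = a *\<^sub>C x + a *\<^sub>C y"
    and scaleC_add_left: "(a + b) *\<^sub>C x = a *\<^sub>C x + b *\<^sub>C x"
    and scaleC_scaleC: "a *\<^sub>C (b *\<^sub>C x) = (a * b) *\<^sub>C x"
    and scaleC_one: "1 *\<^sub>C x = x"
    and cinner_commute: "cinner x y = cnj (cinner y x)"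
    and cinner_add_left: "cinner (x + y) z = cinner x z + cinner y z"
    and cinner_scaleC_left: "cinner (a *\<^sub>C x) y = a * cinner x y"
    and cinner_self_nonneg: "0 \<le> Re (cinner x x)"
    and cinner_self_eq_0_iff: "cinner x x = 0 \<longleftrightarrow> x = 0"

interpretation cvec: vector_space "scaleC :: complex \<Rightarrow> 'h \<Rightarrow> 'h::complex_inner"
  by unfold_locales
    (simp_all add: scaleC_add_right scaleC_add_left scaleC_scaleC scaleC_one)

definition has_complex_dimension :: "'h::complex_inner itself \<Rightarrow> nat \<Rightarrow> bool" where
  "has_complex_dimension _ N \<longleftrightarrow>
     (\<exists>B :: 'h set. finite B \<and> card B = N \<and> cvec.independent B \<and> cvec.span B = UNIV)"

definition hnorm :: "'h::complex_inner \<Rightarrow> real" where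
  "hnorm f = sqrt (Re (cinner f f))"

abbreviation clinear :: "('h::complex_inner \<Rightarrow> 'h) \<Rightarrow> bool" where
  "clinear \<equiv> Vector_Spaces.linear scaleC scaleC"

definition invertible_operator :: "('h::complex_inner \<Rightarrow> 'h) \<Rightarrow> bool" where
  "invertible_operator T \<longleftrightarrow> clinear T \<and> bij T"

definition cadjoint :: "('h::complex_inner \<Rightarrow> 'h) \<Rightarrow> 'h \<Rightarrow> 'h" where
  "cadjoint T = (THE T'. \<forall>f g. cinner (T f) g = cinner f (T' g))"

definition normal_operator :: "('h::complex_inner \<Rightarrow> 'h) \<Rightarrow> bool" where
  "normal_operator T \<longleftrightarrow> clinear T \<and> T \<circ> cadjoint T = cadjoint T \<circ> T"

definition positive_operator :: "('h::complex_inner \<Rightarrow> 'h) \<Rightarrow> bool" where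
  "positive_operator T \<longleftrightarrow>
     clinear T \<and> (\<forall>f. cinner (T f) f \<in> \<real> \<and> 0 \<le> Re (cinner (T f) f))"

definition weakly_measurable :: "'s measure \<Rightarrow> ('s \<Rightarrow> 'h::complex_inner) \<Rightarrow> bool" where
  "weakly_measurable M F \<longleftrightarrow> (\<forall>f. (\<lambda>s. cinner f (F s)) \<in> borel_measurable M)"

text \<open>The index set of a family is \<^term>\<open>space M\<close>; values of the family outside it are irrelevant.\<close>

definition controlled_integral_frame ::
    "'s measure \<Rightarrow> ('h::complex_inner \<Rightarrow> 'h) \<Rightarrow> ('s \<Rightarrow> 'h) \<Rightarrow> bool" where
  "controlled_integral_frame M V F \<longleftrightarrow> weakly_measurable M F \<and>
     (\<exists>A B :: real. 0 < A \<and> A \<le> B \<and>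
        (\<forall>f. integrable M (\<lambda>s. cinner f (F s) * cinner (V (F s)) f) \<and>
             (\<integral>s. cinner f (F s) * cinner (V (F s)) f \<partial>M) \<in> \<real> \<and>
             A * (hnorm f)\<^sup>2 \<le> Re (\<integral>s. cinner f (F s) * cinner (V (F s)) f \<partial>M) \<and>
             Re (\<integral>s. cinner f (F s) * cinner (V (F s)) f \<partial>M) \<le> B * (hnorm f)\<^sup>2))"

definition weak_integral :: "'s measure \<Rightarrow> ('s \<Rightarrow> 'h::complex_inner) \<Rightarrow> 'h" where
  "weak_integral M G =
     (THE h. \<forall>g. integrable M (\<lambda>s. cinner (G s) g) \<and> cinner h g = (\<integral>s. cinner (G s) g \<partial>M))"

definition controlled_frame_operator ::
    "'s measure \<Rightarrow> ('h::complex_inner \<Rightarrow> 'h) \<Rightarrow> ('s \<Rightarrow> 'h) \<Rightarrow> 'h \<Rightarrow> 'h" where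
  "controlled_frame_operator M V F f = weak_integral M (\<lambda>s. cinner f (F s) *\<^sub>C V (F s))"

end

theory Submission
  imports Defs "HOL-Computational_Algebra.Fundamental_Theorem_Algebra"
begin

text \<open>
  Besides the controlled form \<open>Q f g = \<integral> \<langle>f, F\<rangle> \<langle>V F, g\<rangle>\<close>, whose operator is \<open>S\<close>, consider the
  uncontrolled frame form \<open>t f g = \<integral> \<langle>f, F\<rangle> \<langle>F, g\<rangle>\<close>. The latter exists because every \<open>\<langle>F, g\<rangle>\<close> can
  be written as \<open>\<langle>V F, k\<rangle>\<close> with \<open>V\<^sup>* k = g\<close>, and the two are tied by \<open>Q f g = t f (V\<^sup>* g)\<close>. The
  frame bounds make \<open>Q\<close> Hermitian and \<open>t\<close> positive definite.

  The relation \<open>V S = S V\<close> says \<open>Q (V f) g = Q f (V\<^sup>* g)\<close>, hence \<open>t (V f) g = t f (V\<^sup>* g)\<close>, as \<open>V\<^sup>*\<close>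
  is onto. The symmetry of \<open>Q\<close> says \<open>t f (V\<^sup>* g) = t (V\<^sup>* f) g\<close>. Definiteness of \<open>t\<close> then gives
  \<open>V = V\<^sup>*\<close>. Finally, for an eigenvector \<open>V v = z v\<close> one has \<open>Q v v = cnj z * t v v\<close> with both forms
  positive, so all eigenvalues of the self-adjoint operator \<open>V\<close> are positive
  (lemma \<open>frame_eigenvalue_pos\<close>), and \<open>V\<close> is positive by diagonalization
  (lemma \<open>selfadjoint_nonneg_if_eigenvalues_nonneg\<close>).
\<close>

section \<open>Complex inner products and sesquilinear forms\<close>

lemma cinner_add_right: "cinner x (y + z) = cinner x y + cinner x z"
  by (metis cinner_commute cinner_add_left complex_cnj_add)

lemma cinner_scaleC_right: "cinner x (a *\<^sub>C y) = cnj a * cinner x y"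
  by (metis cinner_commute cinner_scaleC_left complex_cnj_mult)

lemma cinner_zero_left [simp]: "cinner 0 y = 0"
  using cinner_add_left[of 0 0 y] by simp

lemma cinner_zero_right [simp]: "cinner x 0 = 0"
  using cinner_add_right[of x 0 0] by simp

lemma cinner_diff_left: "cinner (x - y) z = cinner x z - cinner y z"
  using cinner_add_left[of "x - y" y z] by simp

lemma eq_if_cinner_eq: "(\<And>g. cinner x g = cinner y g) \<Longrightarrow> x = y"
  by (metis cinner_diff_left cinner_self_eq_0_iff eq_iff_diff_eq_0)

lemma cinner_self_of_real: "cinner x x = complex_of_real (Re (cinner x x))"
  using cinner_commute[of x x] by (simp add: complex_eq_iff)

lemma clinear_add: "clinear T \<Longrightarrow> T (x + y) = T x + T y"
  by (simp add: Vector_Spaces.linear_iff)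

lemma clinear_scale: "clinear T \<Longrightarrow> T (a *\<^sub>C x) = a *\<^sub>C T x"
  by (simp add: Vector_Spaces.linear_iff)

definition sesquilinear :: "('h::complex_inner \<Rightarrow> 'h \<Rightarrow> complex) \<Rightarrow> bool" where
  "sesquilinear B \<longleftrightarrow>
     (\<forall>x y z. B (x + y) z = B x z + B y z) \<and> (\<forall>x y z. B x (y + z) = B x y + B x z) \<and>
     (\<forall>a x y. B (a *\<^sub>C x) y = a * B x y) \<and> (\<forall>a x y. B x (a *\<^sub>C y) = cnj a * B x y)"

lemma sesquilinearD:
  assumes "sesquilinear B"
  shows "B (x + y) z = B x z + B y z" "B x (y + z) = B x y + B x z"
    "B (a *\<^sub>C x) y = a * B x y" "B x (a *\<^sub>C y) = cnj a * B x y"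
  using assms by (simp_all add: sesquilinear_def)

lemma sesquilinear_diff_left:
  assumes "sesquilinear B"
  shows "B (x - y) z = B x z - B y z"
  using sesquilinearD(1)[OF assms, of "x - y" y z] by simp

lemma sesquilinear_polarization:
  assumes "sesquilinear B"
  shows "B f g = (B (f + g) (f + g) - B (f + (-1) *\<^sub>C g) (f + (-1) *\<^sub>C g)
           + \<i> * B (f + \<i> *\<^sub>C g) (f + \<i> *\<^sub>C g) - \<i> * B (f + (-\<i>) *\<^sub>C g) (f + (-\<i>) *\<^sub>C g)) / 4"
  unfolding sesquilinearD[OF assms] by (simp add: algebra_simps)

lemma sesquilinear_hermitian_if_real_diagonal:
  assumes "sesquilinear B" and real: "\<And>f. B f f \<in> \<real>"
  shows "B f g = cnj (B g f)"
proof -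
  have im: "Im (B x x) = 0" for x
    using real[of x] by (simp add: complex_is_Real_iff)
  \<comment> \<open>The two diagonal values give \<open>Im (B f g) = - Im (B g f)\<close> and \<open>Re (B f g) = Re (B g f)\<close>.\<close>
  from im[of "f + g"] im[of "f + \<i> *\<^sub>C g"] show ?thesis
    by (simp add: sesquilinearD[OF assms(1)] im complex_eq_iff)
qed

lemma sesquilinear_integral:
  assumes "\<And>s. sesquilinear (b s)" and "\<And>f g. integrable M (\<lambda>s. b s f g)"
  shows "sesquilinear (\<lambda>f g. \<integral>s. b s f g \<partial>M)"
  using assms(2) by (simp add: sesquilinear_def sesquilinearD[OF assms(1)])

section \<open>Riesz representation and adjoints in finite dimension\<close>

text \<open>Induction over the spanning set. The induction hypothesis is used twice: it represents the
  functional on the smaller span, and, for the functional \<open>\<langle>b, \<cdot>\<rangle>\<close>, it yields the orthogonal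
  projection of the new vector \<open>b\<close>, so that a multiple of the orthogonal remainder corrects the
  representing vector.\<close>

lemma riesz_on_span:
  fixes \<phi> :: "'h::complex_inner \<Rightarrow> complex"
  assumes "finite B"
    and "\<And>x y. \<phi> (x + y) = \<phi> x + \<phi> y" and "\<And>a x. \<phi> (a *\<^sub>C x) = cnj a * \<phi> x"
  shows "\<exists>h \<in> cvec.span B. \<forall>g \<in> cvec.span B. cinner h g = \<phi> g"
  using assms
proof (induction B arbitrary: \<phi> rule: finite_induct)
  case empty
  have "\<phi> 0 = 0"
    using empty(1)[of 0 0] by simp
  then show ?case by simp
next
  case (insert b B)
  obtain h where h: "h \<in> cvec.span B" "\<And>g. g \<in> cvec.span B \<Longrightarrow> cinner h g = \<phi> g"
    using insert.IH[of \<phi>] insert.prems by blast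
  obtain p where p: "p \<in> cvec.span B" "\<And>g. g \<in> cvec.span B \<Longrightarrow> cinner p g = cinner b g"
    using insert.IH[of "cinner b"] by (metis cinner_add_right cinner_scaleC_right)
  define e where "e = b - p"
  have e_orth: "cinner e g = 0" "cinner g e = 0" if "g \<in> cvec.span B" for g
  proof -
    show "cinner e g = 0"
      using p(2)[OF that] by (simp add: e_def cinner_diff_left)
    then show "cinner g e = 0"
      by (metis cinner_commute complex_cnj_zero)
  qed
  define c where "c = \<phi> e / cinner e e"
  have c: "c * cinner e e = \<phi> e"
  proof (cases "e = 0")
    case True
    then show ?thesis
      using insert.prems(1)[of 0 0] by (simp add: c_def)
  next
    case False
    then show ?thesis
      by (simp add: c_def cinner_self_eq_0_iff)
  qed
  have mono: "x \<in> cvec.span (insert b B)" if "x \<in> cvec.span B" for x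
    using that cvec.span_mono[of B "insert b B"] by blast
  have "e \<in> cvec.span (insert b B)"
    unfolding e_def by (intro cvec.span_diff mono[OF p(1)] cvec.span_base) simp
  then have "h + c *\<^sub>C e \<in> cvec.span (insert b B)"
    by (intro cvec.span_add cvec.span_scale mono[OF h(1)])
  moreover have "cinner (h + c *\<^sub>C e) g = \<phi> g" if g: "g \<in> cvec.span (insert b B)" for g
  proof -
    obtain k where k: "g - k *\<^sub>C b \<in> cvec.span B"
      using g by (auto simp: cvec.span_breakdown_eq)
    define g0 where "g0 = (g - k *\<^sub>C b) + k *\<^sub>C p"
    have g0: "g0 \<in> cvec.span B"
      unfolding g0_def by (intro cvec.span_add cvec.span_scale k p)
    have "g = g0 + k *\<^sub>C e"
      by (simp add: g0_def e_def cvec.scale_right_diff_distrib)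
    then show ?thesis
      using c e_orth[OF g0] e_orth[OF h(1)] h(2)[OF g0]
      by (simp add: cinner_add_left cinner_add_right cinner_scaleC_left cinner_scaleC_right
          insert.prems)
  qed
  ultimately show ?case by blast
qed

lemma riesz_representation:
  fixes \<phi> :: "'h::complex_inner \<Rightarrow> complex"
  assumes "has_complex_dimension TYPE('h) N"
    and "\<And>x y. \<phi> (x + y) = \<phi> x + \<phi> y" and "\<And>a x. \<phi> (a *\<^sub>C x) = cnj a * \<phi> x"
  shows "\<exists>h. \<forall>g. cinner h g = \<phi> g"
proof -
  obtain B :: "'h set" where "finite B" "cvec.span B = UNIV"
    using assms(1) by (auto simp: has_complex_dimension_def)
  then show ?thesis
    using riesz_on_span[of B \<phi>] assms(2,3) by auto
qed

text \<open>The adjoint is given by a definite description, which denotes something only because Riesz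
  representation of \<open>f \<mapsto> \<langle>g, T f\<rangle>\<close> produces a map with the defining property.\<close>

lemma cinner_cadjoint:
  fixes T :: "'h::complex_inner \<Rightarrow> 'h"
  assumes dim: "has_complex_dimension TYPE('h) N" and T: "clinear T"
  shows "cinner (T f) g = cinner f (cadjoint T g)"
proof -
  have "\<exists>h. \<forall>f. cinner h f = cinner g (T f)" for g
    by (rule riesz_representation[OF dim])
      (simp_all add: clinear_add[OF T] clinear_scale[OF T] cinner_add_right cinner_scaleC_right)
  then obtain T' where "\<And>g f. cinner (T' g) f = cinner g (T f)"
    by metis
  then have T': "\<forall>f g. cinner (T f) g = cinner f (T' g)"
    by (metis cinner_commute)
  have unique: "T'' = T'" if "\<forall>f g. cinner (T f) g = cinner f (T'' g)" for T''
  proof (intro ext eq_if_cinner_eq)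
    fix g f
    show "cinner (T'' g) f = cinner (T' g) f"
      using that T' by (metis cinner_commute)
  qed
  show ?thesis
    unfolding cadjoint_def using theI[where P = "\<lambda>T'. \<forall>f g. cinner (T f) g = cinner f (T' g)", OF T' unique] by blast
qed

lemma surj_cadjoint:
  fixes T :: "'h::complex_inner \<Rightarrow> 'h"
  assumes dim: "has_complex_dimension TYPE('h) N" and "invertible_operator T"
  shows "surj (cadjoint T)"
proof (rule surjI)
  have T: "clinear T" and "bij T"
    using assms(2) by (simp_all add: invertible_operator_def)
  have left: "inv T (T x) = x" and right: "T (inv T x) = x" for x
    using \<open>bij T\<close> by (simp_all add: bij_is_inj bij_is_surj surj_f_inv_f)
  have "clinear (inv T)"
  proof (rule Vector_Spaces.linear_iff[THEN iffD2], intro conjI allI)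
    show "inv T (x + y) = inv T x + inv T y" for x y
      by (metis left right clinear_add[OF T])
    show "inv T (a *\<^sub>C x) = a *\<^sub>C inv T x" for a x
      by (metis left right clinear_scale[OF T])
  qed (rule cvec.vector_space_axioms)+
  then show "cadjoint T (cadjoint (inv T) g) = g" for g
    by (intro eq_if_cinner_eq)
      (metis cinner_commute cinner_cadjoint[OF dim] T left)
qed

section \<open>Self-adjoint operators and their eigenvalues\<close>

text \<open>The value \<open>p(T) f\<close>, in Horner form: this makes the recursion \<open>poly_apply_pCons\<close> hold without
  side conditions, so that everything below is an induction over \<open>pCons\<close>.\<close>

definition poly_apply :: "('h::complex_inner \<Rightarrow> 'h) \<Rightarrow> complex poly \<Rightarrow> 'h \<Rightarrow> 'h" where
  "poly_apply T p f = fold_coeffs (\<lambda>a x. a *\<^sub>C f + T x) p 0"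

lemma poly_apply_0 [simp]: "poly_apply T 0 f = 0"
  by (simp add: poly_apply_def)

context
  fixes T :: "'h::complex_inner \<Rightarrow> 'h"
  assumes T: "clinear T"
begin

lemma clinear_zero: "T 0 = 0"
  using clinear_add[OF T, of 0 0] by simp

lemma poly_apply_pCons: "poly_apply T (pCons a p) f = a *\<^sub>C f + T (poly_apply T p f)"
  by (cases "p = 0 \<and> a = 0") (auto simp: poly_apply_def clinear_zero)

lemma poly_apply_add: "poly_apply T (p + q) f = poly_apply T p f + poly_apply T q f"
  by (induction p q rule: poly_induct2)
    (simp_all add: poly_apply_pCons clinear_add[OF T] scaleC_add_left)

lemma poly_apply_smult: "poly_apply T (smult c p) f = c *\<^sub>C poly_apply T p f"
  by (induction p)
    (simp_all add: poly_apply_pCons clinear_scale[OF T] scaleC_add_right scaleC_scaleC)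

lemma poly_apply_sum: "poly_apply T (\<Sum>i\<in>A. p i) f = (\<Sum>i\<in>A. poly_apply T (p i) f)"
  by (induction A rule: infinite_finite_induct) (simp_all add: poly_apply_add)

lemma poly_apply_monom: "poly_apply T (monom c n) f = c *\<^sub>C (T ^^ n) f"
  by (induction n)
    (simp_all add: monom_0 monom_Suc poly_apply_pCons clinear_zero clinear_scale[OF T])

lemma poly_apply_linear_factor:
  "poly_apply T ([:-z, 1:] * q) f = T (poly_apply T q f) - z *\<^sub>C poly_apply T q f"
proof -
  have "[:-z, 1:] * q = smult (-z) q + pCons 0 q"
    by simp
  then show ?thesis
    by (simp only: poly_apply_add poly_apply_smult poly_apply_pCons) simp
qed

lemma poly_apply_vec_add: "poly_apply T p (f + g) = poly_apply T p f + poly_apply T p g"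
  by (induction p) (simp_all add: poly_apply_pCons clinear_add[OF T] scaleC_add_right)

lemma poly_apply_eigenvector:
  assumes "T u = z *\<^sub>C u"
  shows "poly_apply T p u = poly p z *\<^sub>C u"
  by (induction p)
    (simp_all add: poly_apply_pCons clinear_scale[OF T] assms scaleC_scaleC scaleC_add_left
      mult.commute)

text \<open>The only place where finite dimension enters the spectral argument: the iterates of \<open>T\<close> on
  \<open>f\<close> are linearly dependent. A repetition among them has to be treated apart, since independence
  of the set of iterates does not see it.\<close>

lemma annihilating_poly_exists:
  assumes "has_complex_dimension TYPE('h) N"
  shows "\<exists>p. p \<noteq> 0 \<and> poly_apply T p f = 0"
proof (cases "inj_on (\<lambda>i. (T ^^ i) f) {..N}")
  case False
  then obtain i j where ij: "i \<noteq> j" "(T ^^ i) f = (T ^^ j) f"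
    by (auto simp: inj_on_def)
  have "coeff (monom 1 i + monom (- 1) j :: complex poly) i \<noteq> 0"
    using ij(1) by simp
  then have "monom 1 i + monom (- 1) j \<noteq> (0 :: complex poly)"
    by (metis coeff_0)
  moreover have "poly_apply T (monom 1 i + monom (- 1) j) f = 0"
    by (simp add: poly_apply_add poly_apply_monom ij(2))
  ultimately show ?thesis by blast
next
  case inj: True
  obtain B :: "'h set" where B: "finite B" "card B = N" "cvec.span B = UNIV"
    using assms by (auto simp: has_complex_dimension_def)
  define X where "X = (\<lambda>i. (T ^^ i) f) ` {..N}"
  have "card X = Suc N"
    using inj by (simp add: X_def card_image)
  then have "cvec.dependent X"
    using cvec.independent_span_bound[of B X] B by auto
  moreover have "finite X"
    by (simp add: X_def)
  ultimately obtain c x where x: "x \<in> X" "c x \<noteq> 0" and sum: "(\<Sum>v\<in>X. c v *\<^sub>C v) = 0"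
    by (auto simp: cvec.dependent_finite)
  define p where "p = (\<Sum>i\<le>N. monom (c ((T ^^ i) f)) i)"
  obtain i where i: "i \<le> N" "x = (T ^^ i) f"
    using x(1) by (auto simp: X_def)
  have "coeff p i = c x"
    using i by (simp add: p_def coeff_sum)
  then have "p \<noteq> 0"
    using x(2) by auto
  moreover have "poly_apply T p f = 0"
    using sum inj by (simp add: p_def poly_apply_sum poly_apply_monom X_def sum.reindex)
  ultimately show ?thesis by blast
qed

context
  assumes selfadjoint: "\<And>x y. cinner (T x) y = cinner x (T y)"
begin

lemma poly_apply_orthogonal_eigenvector:
  assumes "T u = z *\<^sub>C u" and "cinner w u = 0"
  shows "cinner (poly_apply T p w) u = 0"
  by (induction p)
    (simp_all add: poly_apply_pCons cinner_add_left cinner_scaleC_left selfadjoint assms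
      cinner_scaleC_right)

text \<open>Induction on the degree of a polynomial with \<open>p(T) f = 0\<close>. Split off a root, \<open>p = (X - z) q\<close>;
  then \<open>u = q(T) f\<close> satisfies \<open>T u = z u\<close>. The part \<open>w\<close> of \<open>f\<close> orthogonal to \<open>u\<close> is annihilated by
  \<open>q\<close>, because \<open>q(T) w\<close> is both a multiple of \<open>u\<close> and orthogonal to \<open>u\<close>; and \<open>\<langle>T f, f\<rangle>\<close> is the sum
  of the contributions of \<open>w\<close> and of the component along \<open>u\<close>.\<close>

lemma nonneg_if_annihilated:
  assumes eig: "\<And>u z. u \<noteq> 0 \<Longrightarrow> T u = z *\<^sub>C u \<Longrightarrow> 0 \<le> Re z"
  shows "p \<noteq> 0 \<Longrightarrow> poly_apply T p f = 0 \<Longrightarrow> 0 \<le> Re (cinner (T f) f)"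
proof (induction "degree p" arbitrary: p f)
  case 0
  then obtain c where "p = [:c:]" "c \<noteq> 0"
    by (metis degree_eq_zeroE pCons_0_0)
  with 0 have "f = 0"
    by (simp add: poly_apply_pCons clinear_zero)
  then show ?case by simp
next
  case (Suc n)
  have "\<not> constant (poly p)"
    using Suc.hyps(2) by (simp add: constant_degree)
  then obtain z where "poly p z = 0"
    using fundamental_theorem_of_algebra by blast
  then obtain q where q: "p = [:-z, 1:] * q"
    by (auto simp: poly_eq_0_iff_dvd)
  have "q \<noteq> 0"
    using q Suc.prems(1) by auto
  then have deg: "n = degree q"
    using q Suc.hyps(2) degree_mult_eq[of "[:-z, 1:]" q] by simp
  define u where "u = poly_apply T q f"
  have Tu: "T u = z *\<^sub>C u"
    using Suc.prems(2) unfolding q poly_apply_linear_factor by (simp add: u_def)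
  show ?case
  proof (cases "u = 0")
    case True
    then show ?thesis
      using Suc.hyps(1)[OF deg \<open>q \<noteq> 0\<close>] by (simp add: u_def)
  next
    case False
    define a where "a = cinner f u / cinner u u"
    define w where "w = f - a *\<^sub>C u"
    have uu: "cinner u u \<noteq> 0"
      using False by (simp add: cinner_self_eq_0_iff)
    have wu: "cinner w u = 0"
      using uu by (simp add: w_def cinner_diff_left cinner_scaleC_left a_def)
    have uw: "cinner u w = 0"
      by (metis wu cinner_commute complex_cnj_zero)
    have f: "f = w + a *\<^sub>C u"
      by (simp add: w_def)
    define c where "c = 1 - poly q z * a"
    have "u = poly_apply T q w + (poly q z * a) *\<^sub>C u"
      using poly_apply_vec_add[of q w "a *\<^sub>C u"] poly_apply_eigenvector[of "a *\<^sub>C u" z q]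
      by (simp add: u_def[symmetric] f[symmetric] clinear_scale[OF T] Tu scaleC_scaleC mult.commute)
    then have qw: "poly_apply T q w = c *\<^sub>C u"
      by (simp add: c_def cvec.scale_left_diff_distrib scaleC_one eq_diff_eq)
    then have "c * cinner u u = 0"
      using poly_apply_orthogonal_eigenvector[OF Tu wu, of q] by (simp add: cinner_scaleC_left)
    then have "poly_apply T q w = 0"
      using qw uu by simp
    then have IH: "0 \<le> Re (cinner (T w) w)"
      using Suc.hyps(1)[OF deg \<open>q \<noteq> 0\<close>] by blast
    have "cinner (T w) u = 0"
      by (simp add: selfadjoint Tu cinner_scaleC_right wu)
    then have "cinner (T f) f = cinner (T w) w + (a * cnj a) * z * cinner u u"
      unfolding f
      by (simp add: clinear_add[OF T] clinear_scale[OF T] Tu cinner_add_left cinner_add_right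
          cinner_scaleC_left cinner_scaleC_right uw)
    also have "(a * cnj a) * z * cinner u u
        = complex_of_real ((cmod a)\<^sup>2 * Re (cinner u u)) * z"
      by (subst cinner_self_of_real) (simp add: complex_norm_square[symmetric])
    finally show ?thesis
      using IH eig[OF False Tu] cinner_self_nonneg[of u] by simp
  qed
qed

lemma selfadjoint_nonneg_if_eigenvalues_nonneg:
  assumes "has_complex_dimension TYPE('h) N"
    and "\<And>u z. u \<noteq> 0 \<Longrightarrow> T u = z *\<^sub>C u \<Longrightarrow> 0 \<le> Re z"
  shows "0 \<le> Re (cinner (T f) f)"
proof -
  obtain p where "p \<noteq> 0" "poly_apply T p f = 0"
    using annihilating_poly_exists[OF assms(1)] by blast
  with assms(2) show ?thesis
    by (rule nonneg_if_annihilated)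
qed

end

end

section \<open>The forms of a controlled integral frame\<close>

definition controlled_frame_form ::
    "'s measure \<Rightarrow> ('h::complex_inner \<Rightarrow> 'h) \<Rightarrow> ('s \<Rightarrow> 'h) \<Rightarrow> 'h \<Rightarrow> 'h \<Rightarrow> complex" where
  "controlled_frame_form M V F f g = (\<integral>s. cinner f (F s) * cinner (V (F s)) g \<partial>M)"

abbreviation frame_form :: "'s measure \<Rightarrow> ('s \<Rightarrow> 'h::complex_inner) \<Rightarrow> 'h \<Rightarrow> 'h \<Rightarrow> complex" where
  "frame_form M F \<equiv> controlled_frame_form M id F"

lemma sesquilinear_integrand: "sesquilinear (\<lambda>f g. cinner f x * cinner y g)"
  by (simp add: sesquilinear_def cinner_add_left cinner_add_right cinner_scaleC_left
      cinner_scaleC_right algebra_simps)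

context
  fixes M :: "'s measure" and V :: "'h::complex_inner \<Rightarrow> 'h" and F :: "'s \<Rightarrow> 'h" and N :: nat
  assumes dim: "has_complex_dimension TYPE('h) N"
    and inv: "invertible_operator V"
    and frame: "controlled_integral_frame M V F"
begin

lemma V_linear: "clinear V"
  using inv by (simp add: invertible_operator_def)

text \<open>The frame condition speaks of the diagonal only; polarization extends integrability to all
  pairs of vectors.\<close>

lemma controlled_integrable: "integrable M (\<lambda>s. cinner f (F s) * cinner (V (F s)) g)"
proof -
  have diag: "integrable M (\<lambda>s. cinner h (F s) * cinner (V (F s)) h)" for h
    using frame by (auto simp: controlled_integral_frame_def)
  show ?thesis
    by (subst sesquilinear_polarization[OF sesquilinear_integrand])
      (intro diag Bochner_Integration.integrable_add Bochner_Integration.integrable_diff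
        integrable_mult_right integrable_divide)
qed

lemma frame_integrable: "integrable M (\<lambda>s. cinner f (F s) * cinner (F s) g)"
proof -
  obtain k where "g = cadjoint V k"
    using surj_cadjoint[OF dim inv] by (metis surjD)
  then show ?thesis
    using controlled_integrable[of f k] by (simp add: cinner_cadjoint[OF dim V_linear])
qed

lemma sesquilinear_controlled_frame_form: "sesquilinear (controlled_frame_form M V F)"
  using sesquilinear_integral[OF sesquilinear_integrand controlled_integrable]
  by (simp add: controlled_frame_form_def [abs_def])

lemma sesquilinear_frame_form: "sesquilinear (frame_form M F)"
  using sesquilinear_integral[OF sesquilinear_integrand frame_integrable]
  by (simp add: controlled_frame_form_def [abs_def])

lemma controlled_frame_form_eq: "controlled_frame_form M V F f g = frame_form M F f (cadjoint V g)"
  by (simp add: controlled_frame_form_def cinner_cadjoint[OF dim V_linear])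

lemma cinner_controlled_frame_operator:
  "cinner (controlled_frame_operator M V F f) g = controlled_frame_form M V F f g"
proof -
  obtain h where h: "\<And>g. cinner h g = controlled_frame_form M V F f g"
    using riesz_representation[OF dim, of "controlled_frame_form M V F f"]
      sesquilinearD[OF sesquilinear_controlled_frame_form] by metis
  have "controlled_frame_operator M V F f = h"
    unfolding controlled_frame_operator_def weak_integral_def
  proof (rule the_equality)
    show "\<forall>g. integrable M (\<lambda>s. cinner (cinner f (F s) *\<^sub>C V (F s)) g) \<and>
        cinner h g = (\<integral>s. cinner (cinner f (F s) *\<^sub>C V (F s)) g \<partial>M)"
      by (simp add: cinner_scaleC_left controlled_integrable h controlled_frame_form_def)
  next
    fix h'
    assume "\<forall>g. integrable M (\<lambda>s. cinner (cinner f (F s) *\<^sub>C V (F s)) g) \<and>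
        cinner h' g = (\<integral>s. cinner (cinner f (F s) *\<^sub>C V (F s)) g \<partial>M)"
    then show "h' = h"
      by (intro eq_if_cinner_eq) (simp add: cinner_scaleC_left h controlled_frame_form_def)
  qed
  then show ?thesis
    by (simp add: h)
qed

lemma controlled_frame_form_hermitian:
  "controlled_frame_form M V F f g = cnj (controlled_frame_form M V F g f)"
  using frame
  by (intro sesquilinear_hermitian_if_real_diagonal[OF sesquilinear_controlled_frame_form])
    (auto simp: controlled_integral_frame_def controlled_frame_form_def)

lemma controlled_frame_form_pos:
  assumes "f \<noteq> 0"
  shows "0 < Re (controlled_frame_form M V F f f)"
proof -
  obtain A where A: "0 < A" "A * (hnorm f)\<^sup>2 \<le> Re (controlled_frame_form M V F f f)"
    using frame by (auto simp: controlled_integral_frame_def controlled_frame_form_def)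
  have "Re (cinner f f) \<noteq> 0"
    using assms cinner_self_of_real[of f] cinner_self_eq_0_iff[of f] by auto
  then have "0 < hnorm f"
    using cinner_self_nonneg[of f] by (simp add: hnorm_def)
  with A show ?thesis
    by (meson less_le_trans mult_pos_pos zero_less_power)
qed

lemma frame_form_hermitian: "frame_form M F f g = cnj (frame_form M F g f)"
proof -
  have "cnj (cinner g (F s) * cinner (F s) f) = cinner f (F s) * cinner (F s) g" for s
    using cinner_commute[of "F s" g] cinner_commute[of f "F s"] by simp
  then show ?thesis
    by (simp add: controlled_frame_form_def Bochner_Integration.integral_cnj[symmetric])
qed

text \<open>If \<open>t f f = 0\<close>, then \<open>\<langle>f, F\<rangle>\<close> vanishes almost everywhere, and so does the integrand of
  \<open>Q f f\<close>; the lower frame bound excludes this unless \<open>f = 0\<close>.\<close>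

lemma frame_form_pos:
  assumes "f \<noteq> 0"
  shows "0 < Re (frame_form M F f f)"
proof -
  define r where "r s = (cmod (cinner f (F s)))\<^sup>2" for s
  have r: "cinner f (F s) * cinner (F s) f = complex_of_real (r s)" for s
    using cinner_commute[of "F s" f] by (simp only: r_def complex_norm_square)
  have int: "integrable M r"
    using integrable_Re[OF frame_integrable[of f f]] by (simp add: r)
  have form: "Re (frame_form M F f f) = (\<integral>s. r s \<partial>M)"
    by (simp add: controlled_frame_form_def r)
  have nonneg: "AE s in M. 0 \<le> r s"
    by (simp add: r_def)
  have "(\<integral>s. r s \<partial>M) \<noteq> 0"
  proof
    assume "(\<integral>s. r s \<partial>M) = 0"
    then have "AE s in M. r s = 0"
      using integral_nonneg_eq_0_iff_AE[OF int nonneg] by simp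
    then have "AE s in M. cinner f (F s) * cinner (V (F s)) f = 0"
      by eventually_elim (simp add: r_def)
    then have "controlled_frame_form M V F f f = 0"
      unfolding controlled_frame_form_def by (rule integral_eq_zero_AE)
    then show False
      using controlled_frame_form_pos[OF assms] by simp
  qed
  moreover have "0 \<le> (\<integral>s. r s \<partial>M)"
    using nonneg by (rule integral_nonneg_AE)
  ultimately show ?thesis
    by (simp add: form)
qed

context
  assumes commute: "V \<circ> controlled_frame_operator M V F = controlled_frame_operator M V F \<circ> V"
begin

text \<open>The commutation relation only gives this identity for \<open>g = V\<^sup>* k\<close>; invertibility of \<open>V\<close> makes
  every \<open>g\<close> of that form.\<close>

lemma frame_form_shift: "frame_form M F (V f) g = frame_form M F f (cadjoint V g)"
proof -
  let ?S = "controlled_frame_operator M V F"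
  obtain k where k: "g = cadjoint V k"
    using surj_cadjoint[OF dim inv] by (metis surjD)
  have "frame_form M F (V f) g = cinner (?S (V f)) k"
    by (simp add: k cinner_controlled_frame_operator controlled_frame_form_eq)
  also have "\<dots> = cinner (V (?S f)) k"
    using commute by (metis comp_apply)
  also have "\<dots> = frame_form M F f (cadjoint V g)"
    by (simp add: k cinner_cadjoint[OF dim V_linear] cinner_controlled_frame_operator
        controlled_frame_form_eq)
  finally show ?thesis .
qed

text \<open>Both \<open>t (V f) g\<close> and \<open>t (V\<^sup>* f) g\<close> equal \<open>Q f g\<close>, the latter through the symmetry of the two
  forms; as \<open>t\<close> is definite, the difference \<open>V f - V\<^sup>* f\<close> vanishes.\<close>

lemma cadjoint_V_eq: "cadjoint V f = V f"
proof (rule ccontr)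
  assume "cadjoint V f \<noteq> V f"
  then have ne: "V f - cadjoint V f \<noteq> 0"
    by simp
  have "frame_form M F (V f) g = frame_form M F (cadjoint V f) g" for g
  proof -
    have "frame_form M F (V f) g = controlled_frame_form M V F f g"
      by (simp only: frame_form_shift controlled_frame_form_eq)
    also have "\<dots> = cnj (controlled_frame_form M V F g f)"
      by (rule controlled_frame_form_hermitian)
    also have "\<dots> = frame_form M F (cadjoint V f) g"
      by (simp only: controlled_frame_form_eq frame_form_hermitian[symmetric])
    finally show ?thesis .
  qed
  then have "frame_form M F (V f - cadjoint V f) (V f - cadjoint V f) = 0"
    by (simp add: sesquilinear_diff_left[OF sesquilinear_frame_form])
  then show False
    using frame_form_pos[OF ne] by simp
qed

lemma V_selfadjoint: "cinner (V f) g = cinner f (V g)"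
  by (simp add: cinner_cadjoint[OF dim V_linear] cadjoint_V_eq)

lemma frame_eigenvalue_pos:
  assumes "u \<noteq> 0" and "V u = z *\<^sub>C u"
  shows "0 < Re z"
proof -
  have "controlled_frame_form M V F u u = cnj z * frame_form M F u u"
    by (simp add: controlled_frame_form_eq cadjoint_V_eq assms(2)
        sesquilinearD[OF sesquilinear_frame_form])
  moreover have "Im (frame_form M F u u) = 0"
    using frame_form_hermitian[of u u] by (simp add: complex_eq_iff)
  ultimately have "Re (controlled_frame_form M V F u u) = Re z * Re (frame_form M F u u)"
    by simp
  then show ?thesis
    using controlled_frame_form_pos[OF assms(1)] frame_form_pos[OF assms(1)]
    by (metis less_eq_real_def zero_less_mult_pos2)
qed

end

end

theorem theorem2p9:
  fixes M :: "'s measure"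
    and V :: "'h::complex_inner \<Rightarrow> 'h"
    and F :: "'s \<Rightarrow> 'h"
    and N :: nat
  assumes "has_complex_dimension TYPE('h) N"
    and "invertible_operator V"
    and "controlled_integral_frame M V F"
    and "normal_operator (controlled_frame_operator M V F)"
    and "V \<circ> controlled_frame_operator M V F = controlled_frame_operator M V F \<circ> V"
  shows "positive_operator V"
proof -
  note dim = assms(1) and hyps = assms(1,2,3,5)
  have lin: "clinear V"
    using assms(2) by (simp add: invertible_operator_def)
  have selfadjoint: "cinner (V f) g = cinner f (V g)" for f g
    by (rule V_selfadjoint[OF hyps])
  have "0 \<le> Re (cinner (V f) f)" for f
    using selfadjoint_nonneg_if_eigenvalues_nonneg[OF lin selfadjoint dim]
      frame_eigenvalue_pos[OF hyps] by (meson less_imp_le)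
  moreover have "cinner (V f) f \<in> \<real>" for f
    by (metis selfadjoint cinner_commute Reals_cnj_iff)
  ultimately show ?thesis
    using lin by (simp add: positive_operator_def)
qed

end
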